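(* Let $(A_{\tau,\sigma},B_\tau,C_\tau)$ be the coefficients of a continuous-stage Runge-Kutta (csRK) method such that $C_\tau=\int_0^1A_{\tau,\sigma}\,d\sigma$ for all $\tau\in[0,1]$, and such that for some integer $\rho\ge 1$ $$\int_0^1B_\tau C_\tau^{\kappa-1}\,d\tau=\frac1\kappa,\qquad \kappa=1,\dots,\rho.$$ If $$A_{\tau,\sigma}+A_{1-\tau,1-\sigma}= B_\sigma\qquad\text{for all }\tau,\sigma\in[0,1],$$ then the csRK method is symmetric.
   Context: csRK method: let $A_{\tau,\sigma}$ be a function of $(\tau,\sigma)\in[0,1]^2$ and $B_\tau, C_\tau$ functions of $\tau\in[0,1]$. Applied to $\dot z=f(t,z)$, $z(t_0)=z_0\in\mathbb{R}^d$, the csRK method with coefficients $(A_{\tau,\sigma},B_\tau,C_\tau)$ and step size $h$ is the one-step method $z_0\mapsto z_1$ from $t_0$ to $t_1=t_0+h$ given by $$Z_\tau=z_0+h\int_0^1 A_{\tau,\sigma}f(t_0+C_\sigma h,Z_\sigma)\,d\sigma,\ \tau\in[0,1],\qquad z_1=z_0+h\int_0^1 B_\tau f(t_0+C_\tau h,Z_\tau)\,d\tau .$$ (If $f$ is Lipschitz with constant $L$, the system has a unique solution for $|h|<1/(L\max_{\tau}\int_0^1|A_{\tau,\sigma}|\,d\sigma)$.) Symmetry: a one-step method $\phi_h$ is symmetric (time-reversible) if $\phi_h^*=\phi_h$, where $\phi_h^*=\phi_{-h}^{-1}$ is the adjoint method. Equivalently, exchanging $h\leftrightarrow -h$, $z_0\leftrightarrow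 z_1$ and $t_0\leftrightarrow t_1$ in the relation $z_1=\phi_h(z_0;t_0,t_1)$ leaves the method unaltered. *)

theory Defs
  imports "HOL-Analysis.Analysis"
begin

text \<open>
  A one-step method assigns to a right-hand side \<open>f\<close>, a step size \<open>h\<close> and an initial time \<open>t0\<close> the
  set of all pairs \<open>(z0, z1)\<close> such that \<open>z1\<close> is a result of the step from \<open>t0\<close> to \<open>t0 + h\<close> started
  at \<open>z0\<close>. This is the graph of \<open>z0 \<mapsto> z1\<close> wherever the method is well defined; an implicit method
  determines \<open>z1\<close> uniquely only for small \<open>h\<close>, so a total function would be inadequate.
\<close>

type_synonym 'v one_step_method =
  "(real \<Rightarrow> 'v \<Rightarrow> 'v) \<Rightarrow> real \<Rightarrow> real \<Rightarrow> ('v \<times> 'v) set"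

definition csRK_stages ::
  "(real \<Rightarrow> real \<Rightarrow> real) \<Rightarrow> (real \<Rightarrow> real) \<Rightarrow> (real \<Rightarrow> real ^ 'd \<Rightarrow> real ^ 'd) \<Rightarrow> real \<Rightarrow> real
    \<Rightarrow> real ^ 'd \<Rightarrow> (real \<Rightarrow> real ^ 'd) \<Rightarrow> bool" where
  "csRK_stages A C f h t0 z0 Z \<longleftrightarrow>
    (\<forall>\<tau>\<in>{0..1}. (\<lambda>\<sigma>. A \<tau> \<sigma> *\<^sub>R f (t0 + C \<sigma> * h) (Z \<sigma>)) integrable_on {0..1} \<and>
      Z \<tau> = z0 + h *\<^sub>R integral {0..1} (\<lambda>\<sigma>. A \<tau> \<sigma> *\<^sub>R f (t0 + C \<sigma> * h) (Z \<sigma>)))"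

definition csRK ::
  "(real \<Rightarrow> real \<Rightarrow> real) \<Rightarrow> (real \<Rightarrow> real) \<Rightarrow> (real \<Rightarrow> real) \<Rightarrow> (real ^ 'd) one_step_method" where
  "csRK A B C f h t0 = {(z0, z1). \<exists>Z. csRK_stages A C f h t0 z0 Z \<and>
      (\<lambda>\<tau>. B \<tau> *\<^sub>R f (t0 + C \<tau> * h) (Z \<tau>)) integrable_on {0..1} \<and>
      z1 = z0 + h *\<^sub>R integral {0..1} (\<lambda>\<tau>. B \<tau> *\<^sub>R f (t0 + C \<tau> * h) (Z \<tau>))}"

text \<open>
  The adjoint \<open>\<phi>\<^sub>h\<^sup>* = (\<phi>\<^sub>-\<^sub>h)\<^sup>-\<^sup>1\<close>: the step being inverted leads from \<open>t0 + h\<close> back to \<open>t0\<close>.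
\<close>

definition adjoint_method :: "'v one_step_method \<Rightarrow> 'v one_step_method" where
  "adjoint_method \<Phi> f h t0 = (\<Phi> f (- h) (t0 + h))\<inverse>"

definition symmetric_method :: "'v one_step_method \<Rightarrow> bool" where
  "symmetric_method \<Phi> \<longleftrightarrow> adjoint_method \<Phi> = \<Phi>"

text \<open>
  Where the steps with \<open>h\<close> and \<open>-h\<close> are maps, symmetry says that the forward map is the inverse
  of the backward one.
\<close>

lemma symmetric_method_map:
  assumes "symmetric_method \<Phi>"
    and "\<Phi> f h t0 = {(z, \<phi> z) |z. True}"
    and "\<Phi> f (- h) (t0 + h) = {(z, \<psi> z) |z. True}"
  shows "bij \<psi>" and "inv \<psi> = \<phi>"
proof -
  have "adjoint_method \<Phi> f h t0 = \<Phi> f h t0"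
    using assms(1) by (simp add: symmetric_method_def)
  then have eq: "{(z, \<psi> z) |z. True}\<inverse> = {(z, \<phi> z) |z. True}"
    by (simp only: adjoint_method_def assms(2,3))
  have \<psi>\<phi>: "\<psi> (\<phi> z) = z" for z
  proof -
    have "(z, \<phi> z) \<in> {(z, \<psi> z) |z. True}\<inverse>" unfolding eq by blast
    then show ?thesis by simp
  qed
  have \<phi>\<psi>: "\<phi> (\<psi> z) = z" for z
  proof -
    have "(\<psi> z, z) \<in> {(z, \<phi> z) |z. True}" unfolding eq[symmetric] by blast
    then show ?thesis by simp
  qed
  show "bij \<psi>"
    by (rule o_bij[of \<phi>]) (auto simp: fun_eq_iff \<psi>\<phi> \<phi>\<psi>)
  show "inv \<psi> = \<phi>"
    by (rule inv_unique_comp) (auto simp: fun_eq_iff \<psi>\<phi> \<phi>\<psi>)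
qed

end

theory Submission
  imports Defs
begin

text \<open>
  Reversing the stages, \<open>\<tau> \<mapsto> Z (1 - \<tau>)\<close>, turns a step from \<open>z0\<close> to \<open>z1\<close> with step size \<open>h\<close>
  into a step from \<open>z1\<close> to \<open>z0\<close> with step size \<open>- h\<close>. The symmetry condition at \<open>(\<tau>, \<sigma>)\<close> and
  \<open>(1 - \<tau>, 1 - \<sigma>)\<close> gives \<open>B (1 - \<sigma>) = B \<sigma>\<close>, and integrating it over \<open>\<sigma>\<close> gives
  \<open>C \<tau> + C (1 - \<tau>) = \<integral> B = 1\<close>, so that the reversed stages are evaluated at the same times. The
  reversed stage equation is then the original one at \<open>1 - \<tau>\<close>, with \<open>z0\<close> expressed through \<open>z1\<close>.
\<close>

text \<open>The substitution \<open>x\<close> to \<open>1 - x\<close> maps the unit interval onto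
  itself and has slope of absolute value 1, so the integral picks up no factor.\<close>

lemma has_integral_reflect_unit_interval:
  fixes f :: "real \<Rightarrow> 'a::banach"
  assumes "(f has_integral I) {0..1}"
  shows "((\<lambda>x. f (1 - x)) has_integral I) {0..1}"
proof -
  have "(\<lambda>x. 1 - x) ` {0..1} = {0..1::real}"
    by (auto simp: image_iff intro: bexI[of _ "1 - _"])
  then show ?thesis
    using has_integral_affinity[of f I 0 1 "-1" 1] assms by simp
qed

lemma csRK_reverse:
  fixes A :: "real \<Rightarrow> real \<Rightarrow> real" and B C :: "real \<Rightarrow> real"
    and f :: "real \<Rightarrow> real ^ 'd \<Rightarrow> real ^ 'd"
  assumes C_eq: "\<And>\<tau>. \<tau> \<in> {0..1} \<Longrightarrow> ((\<lambda>\<sigma>. A \<tau> \<sigma>) has_integral C \<tau>) {0..1}"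
    and B_eq: "(B has_integral 1) {0..1}"
    and sym: "\<And>\<tau> \<sigma>. \<tau> \<in> {0..1} \<Longrightarrow> \<sigma> \<in> {0..1} \<Longrightarrow> A \<tau> \<sigma> + A (1 - \<tau>) (1 - \<sigma>) = B \<sigma>"
    and step: "(z0, z1) \<in> csRK A B C f h t0"
  shows "(z1, z0) \<in> csRK A B C f (- h) (t0 + h)"
proof -
  \<comment> \<open>At \<open>(0, \<sigma>)\<close> and \<open>(1, 1 - \<sigma>)\<close> the two
    summands of the symmetry condition merely change places.\<close>
  have B_sym: "B (1 - \<sigma>) = B \<sigma>" if "\<sigma> \<in> {0..1}" for \<sigma>
    using sym[of 0 \<sigma>] sym[of 1 "1 - \<sigma>"] that by simp
  have C_sym: "C \<tau> + C (1 - \<tau>) = 1" if "\<tau> \<in> {0..1}" for \<tau>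
  proof -
    have "((\<lambda>\<sigma>. A \<tau> \<sigma> + A (1 - \<tau>) (1 - \<sigma>)) has_integral C \<tau> + C (1 - \<tau>)) {0..1}"
      using that by (intro has_integral_add C_eq has_integral_reflect_unit_interval) auto
    then have "(B has_integral C \<tau> + C (1 - \<tau>)) {0..1}"
      by (rule has_integral_eq[rotated]) (use sym that in auto)
    then show ?thesis
      using B_eq by (rule has_integral_unique)
  qed
  obtain Z where stages: "csRK_stages A C f h t0 z0 Z"
    and B_int: "(\<lambda>\<tau>. B \<tau> *\<^sub>R f (t0 + C \<tau> * h) (Z \<tau>)) integrable_on {0..1}"
    and z1: "z1 = z0 + h *\<^sub>R integral {0..1} (\<lambda>\<tau>. B \<tau> *\<^sub>R f (t0 + C \<tau> * h) (Z \<tau>))"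
    using step by (auto simp: csRK_def)
  define g where "g \<sigma> = f (t0 + C \<sigma> * h) (Z \<sigma>)" for \<sigma>
  define J where "J = integral {0..1} (\<lambda>\<sigma>. B \<sigma> *\<^sub>R g \<sigma>)"
  define K where "K \<tau> = integral {0..1} (\<lambda>\<sigma>. A \<tau> \<sigma> *\<^sub>R g \<sigma>)" for \<tau>
  have J: "((\<lambda>\<sigma>. B \<sigma> *\<^sub>R g \<sigma>) has_integral J) {0..1}"
    using B_int unfolding J_def g_def by (rule integrable_integral)
  have K: "((\<lambda>\<sigma>. A \<tau> \<sigma> *\<^sub>R g \<sigma>) has_integral K \<tau>) {0..1}"
    and Z: "Z \<tau> = z0 + h *\<^sub>R K \<tau>" if "\<tau> \<in> {0..1}" for \<tau>
    using stages that unfolding csRK_stages_def K_def g_def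
    by (blast intro: integrable_integral)+
  have z1_J: "z1 = z0 + h *\<^sub>R J"
    using z1 by (simp add: J_def g_def)
  have g_rev: "f (t0 + h + C \<sigma> * - h) (Z (1 - \<sigma>)) = g (1 - \<sigma>)" if "\<sigma> \<in> {0..1}" for \<sigma>
  proof -
    \<comment> \<open>A node at fraction \<open>C \<sigma>\<close> of the backward step is a node at
      fraction \<open>1 - C \<sigma>\<close> of the forward one.\<close>
    have "C (1 - \<sigma>) = 1 - C \<sigma>"
      using C_sym[OF that] by simp
    then have "t0 + C (1 - \<sigma>) * h = t0 + h + C \<sigma> * - h"
      by (simp only:) (simp add: algebra_simps)
    then show ?thesis
      by (simp only: g_def)
  qed
  have J_rev: "((\<lambda>\<sigma>. B \<sigma> *\<^sub>R f (t0 + h + C \<sigma> * - h) (Z (1 - \<sigma>))) has_integral J) {0..1}"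
    by (rule has_integral_eq[OF _ has_integral_reflect_unit_interval[OF J]])
      (simp only: g_rev B_sym)
  have K_rev: "((\<lambda>\<sigma>. A \<tau> \<sigma> *\<^sub>R f (t0 + h + C \<sigma> * - h) (Z (1 - \<sigma>)))
      has_integral J - K (1 - \<tau>)) {0..1}" if \<tau>: "\<tau> \<in> {0..1}" for \<tau>
  proof -
    \<comment> \<open>Reflecting this integrand turns its weight into
      \<open>B (1 - \<sigma>) - A (1 - \<tau>) (1 - \<sigma>)\<close>, which is
      \<open>A \<tau> \<sigma>\<close>.\<close>
    have "((\<lambda>\<sigma>. B \<sigma> *\<^sub>R g \<sigma> - A (1 - \<tau>) \<sigma> *\<^sub>R g \<sigma>) has_integral J - K (1 - \<tau>)) {0..1}"
      using \<tau> by (intro has_integral_diff J K) auto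
    note has_integral_reflect_unit_interval[OF this]
    then show ?thesis
    proof (rule has_integral_eq[rotated])
      fix \<sigma> :: real
      assume \<sigma>: "\<sigma> \<in> {0..1}"
      have "A \<tau> \<sigma> = B (1 - \<sigma>) - A (1 - \<tau>) (1 - \<sigma>)"
        using sym[OF \<tau> \<sigma>] B_sym[OF \<sigma>] by simp
      then show "B (1 - \<sigma>) *\<^sub>R g (1 - \<sigma>) - A (1 - \<tau>) (1 - \<sigma>) *\<^sub>R g (1 - \<sigma>) =
          A \<tau> \<sigma> *\<^sub>R f (t0 + h + C \<sigma> * - h) (Z (1 - \<sigma>))"
        by (simp only: g_rev[OF \<sigma>] scaleR_diff_left)
    qed
  qed
  have "csRK_stages A C f (- h) (t0 + h) z1 (\<lambda>\<tau>. Z (1 - \<tau>))"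
    unfolding csRK_stages_def
  proof (intro ballI conjI)
    fix \<tau> :: real
    assume \<tau>: "\<tau> \<in> {0..1}"
    show "(\<lambda>\<sigma>. A \<tau> \<sigma> *\<^sub>R f (t0 + h + C \<sigma> * - h) (Z (1 - \<sigma>))) integrable_on {0..1}"
      using K_rev[OF \<tau>] by (rule has_integral_integrable)
    \<comment> \<open>The full increment cancels:
      \<open>z1 - h (J - K (1 - \<tau>)) = z0 + h K (1 - \<tau>)\<close>.\<close>
    show "Z (1 - \<tau>) = z1 + - h *\<^sub>R integral {0..1}
        (\<lambda>\<sigma>. A \<tau> \<sigma> *\<^sub>R f (t0 + h + C \<sigma> * - h) (Z (1 - \<sigma>)))"
      using Z[of "1 - \<tau>"] \<tau>
      by (simp only: integral_unique[OF K_rev[OF \<tau>]] z1_J) (simp add: algebra_simps)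
  qed
  moreover have "(\<lambda>\<sigma>. B \<sigma> *\<^sub>R f (t0 + h + C \<sigma> * - h) (Z (1 - \<sigma>))) integrable_on {0..1}"
    using J_rev by (rule has_integral_integrable)
  moreover have "z0 = z1 + - h *\<^sub>R integral {0..1}
      (\<lambda>\<sigma>. B \<sigma> *\<^sub>R f (t0 + h + C \<sigma> * - h) (Z (1 - \<sigma>)))"
    by (simp only: integral_unique[OF J_rev] z1_J) simp
  ultimately show ?thesis
    unfolding csRK_def mem_Collect_eq prod.case by (intro exI conjI)
qed

theorem theorem3p4:
  fixes A :: "real \<Rightarrow> real \<Rightarrow> real" and B C :: "real \<Rightarrow> real" and \<rho> :: nat
  assumes C_eq: "\<And>\<tau>. \<tau> \<in> {0..1} \<Longrightarrow> ((\<lambda>\<sigma>. A \<tau> \<sigma>) has_integral C \<tau>) {0..1}"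
    and \<rho>: "\<rho> \<ge> 1"
    and order: "\<And>\<kappa>. \<kappa> \<in> {1..\<rho>} \<Longrightarrow>
      ((\<lambda>\<tau>. B \<tau> * C \<tau> ^ (\<kappa> - 1)) has_integral 1 / real \<kappa>) {0..1}"
    and sym: "\<And>\<tau> \<sigma>. \<tau> \<in> {0..1} \<Longrightarrow> \<sigma> \<in> {0..1} \<Longrightarrow> A \<tau> \<sigma> + A (1 - \<tau>) (1 - \<sigma>) = B \<sigma>"
  shows "symmetric_method (csRK A B C :: (real ^ 'd) one_step_method)"
proof -
  \<comment> \<open>For \<open>\<kappa> = 1\<close> the power of \<open>C \<tau>\<close> has
    exponent 0, so the condition concerns \<open>B\<close> alone.\<close>
  have B_eq: "(B has_integral 1) {0..1}"
    using order[of 1] \<rho> by simp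
  have reverse: "(z1, z0) \<in> csRK A B C f (- h) (t0 + h)" if "(z0, z1) \<in> csRK A B C f h t0"
    for f :: "real \<Rightarrow> real ^ 'd \<Rightarrow> real ^ 'd" and h t0 z0 z1
    using C_eq B_eq sym that by (rule csRK_reverse)
  have "(z1, z0) \<in> csRK A B C f (- h) (t0 + h) \<longleftrightarrow> (z0, z1) \<in> csRK A B C f h t0"
    for f :: "real \<Rightarrow> real ^ 'd \<Rightarrow> real ^ 'd" and h t0 z0 z1
    \<comment> \<open>Reversing twice restores the data, as \<open>- (- h) = h\<close> and
      \<open>(t0 + h) + (- h) = t0\<close>; hence the second instance is the converse.\<close>
    using reverse[of z0 z1 f h t0] reverse[of z1 z0 f "- h" "t0 + h"] by auto
  then show ?thesis
    by (auto simp: symmetric_method_def adjoint_method_def fun_eq_iff)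
qed

end
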